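(* For every $n\ge3$ and every tree topology $U$ with $n$ nodes, the polyhedron of the STT LP for $U$ has integer vertices (vertices all of whose coordinates are integers) that are not the point induced by any STT over $U$.
   Context: For a tree $U$ and distinct nodes $i,j$, $(i\leftrightsquigarrow j)$ denotes the nodes strictly between $i$ and $j$ on the $U$-path. An STT $T$ over $U$: pick a node $r$ as root; its subtrees are STTs built recursively over the components of $U\setminus\{r\}$. The STT LP for $U$ has variables $D_i$, $X_{ij}$ ($i\ne j$), $Z_{kij}=Z_{kji}$ ($k\in(i\leftrightsquigarrow j)$); constraints $X,Z\ge0$; $X_{ij}+X_{ji}+\sum_{k\in(i\leftrightsquigarrow j)}Z_{kij}\ge1$ for all $i\ne j$; $Z_{kij}\le X_{ki}$, $Z_{kij}\le X_{kj}$; $D_i\ge\sum_{j\ne i}X_{ji}$. The point induced by STT $T$ has $X_{ij}=1$ iff $i$ is a proper ancestor of $j$ in $T$, $Z_{kij}=1$ iff $k$ is the lowest common ancestor of $i,j$ in $T$, all other $X,Z$ zero, and $D_i=\sum_{j\ne i}X_{ji}$. *)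

theory Defs
  imports "HOL-Analysis.Analysis" "HOL-Library.FSet"
begin

text \<open>A simple graph whose node set is the finite type \<open>'v\<close> is given by its adjacency relation.\<close>

type_synonym 'v graph = "'v \<Rightarrow> 'v \<Rightarrow> bool"

definition simple_path :: "'v graph \<Rightarrow> 'v list \<Rightarrow> bool" where
  "simple_path U p \<longleftrightarrow> p \<noteq> [] \<and> distinct p \<and> successively U p"

definition simple_path_between :: "'v graph \<Rightarrow> 'v \<Rightarrow> 'v \<Rightarrow> 'v list \<Rightarrow> bool" where
  "simple_path_between U i j p \<longleftrightarrow> simple_path U p \<and> hd p = i \<and> last p = j"

definition simple_cycle :: "'v graph \<Rightarrow> 'v list \<Rightarrow> bool" where
  "simple_cycle U p \<longleftrightarrow> simple_path U p \<and> length p \<ge> 3 \<and> U (last p) (hd p)"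

definition is_tree :: "'v graph \<Rightarrow> bool" where
  "is_tree U \<longleftrightarrow> symp U \<and> irreflp U \<and>
     (\<forall>i j. \<exists>p. simple_path_between U i j p) \<and> (\<nexists>p. simple_cycle U p)"

text \<open>In a tree the path from \<open>i\<close> to \<open>j\<close> is unique, so the quantifier over \<open>p\<close> picks out that path.\<close>

definition nodes_between :: "'v graph \<Rightarrow> 'v \<Rightarrow> 'v \<Rightarrow> 'v set" where
  "nodes_between U i j = {k. k \<noteq> i \<and> k \<noteq> j \<and> (\<exists>p. simple_path_between U i j p \<and> k \<in> set p)}"

text \<open>Connected components of the subgraph of \<open>U\<close> induced by \<open>S\<close>.\<close>

definition graph_components :: "'v graph \<Rightarrow> 'v set \<Rightarrow> 'v set set" where
  "graph_components U S =
     (\<lambda>v. {w. \<exists>p. simple_path_between U v w p \<and> set p \<subseteq> S}) ` S"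

datatype 'v rtree = Node 'v "'v rtree fset"

text \<open>\<open>stt_on U S T\<close>: \<open>T\<close> is a search tree on the subgraph of \<open>U\<close> induced by \<open>S\<close>;
  \<open>f\<close> assigns to each component of \<open>S - {r}\<close> the child subtree built over it.\<close>

inductive stt_on :: "'v graph \<Rightarrow> 'v set \<Rightarrow> 'v rtree \<Rightarrow> bool" for U where
  "r \<in> S \<Longrightarrow> \<forall>C \<in> graph_components U (S - {r}). stt_on U C (f C) \<Longrightarrow>
   fset ts = f ` graph_components U (S - {r}) \<Longrightarrow> stt_on U S (Node r ts)"

definition stt :: "'v graph \<Rightarrow> 'v rtree \<Rightarrow> bool" where
  "stt U T \<longleftrightarrow> stt_on U UNIV T"

inductive subtree :: "'v rtree \<Rightarrow> 'v rtree \<Rightarrow> bool" where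
  "subtree T T"
| "t |\<in>| ts \<Longrightarrow> subtree s t \<Longrightarrow> subtree s (Node r ts)"

definition proper_ancestor :: "'v rtree \<Rightarrow> 'v \<Rightarrow> 'v \<Rightarrow> bool" where
  "proper_ancestor T i j \<longleftrightarrow> (\<exists>ts t. subtree (Node i ts) T \<and> t |\<in>| ts \<and> j \<in> set_rtree t)"

definition ancestor :: "'v rtree \<Rightarrow> 'v \<Rightarrow> 'v \<Rightarrow> bool" where
  "ancestor T i j \<longleftrightarrow> (\<exists>ts. subtree (Node i ts) T \<and> j \<in> set_rtree (Node i ts))"

definition is_lca :: "'v rtree \<Rightarrow> 'v \<Rightarrow> 'v \<Rightarrow> 'v \<Rightarrow> bool" where
  "is_lca T k i j \<longleftrightarrow> ancestor T k i \<and> ancestor T k j \<and>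
     (\<forall>l. ancestor T l i \<and> ancestor T l j \<longrightarrow> ancestor T l k)"

text \<open>A point is a triple \<open>(D, X, Z)\<close> with coordinates \<open>D $ i\<close>, \<open>X $ i $ j\<close> and \<open>Z $ k $ i $ j\<close>.
  The entries \<open>X $ i $ i\<close>, and \<open>Z $ k $ i $ j\<close> for \<open>i = j\<close> or \<open>k\<close> not strictly between
  \<open>i\<close> and \<open>j\<close>, are not variables of the LP. They are fixed to 0, and \<open>Z\<close> is
  symmetric in \<open>i\<close> and \<open>j\<close>, so the points satisfying \<open>lp_space\<close> form a linear subspace
  that is isomorphic to the space of the actual LP variables.\<close>

type_synonym 'v lp_point = "(real ^ 'v) \<times> (real ^ 'v ^ 'v) \<times> (real ^ 'v ^ 'v ^ 'v)"

definition lp_space :: "'v::finite graph \<Rightarrow> 'v lp_point set" where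
  "lp_space U = {(D, X, Z).
     (\<forall>i. X $ i $ i = 0) \<and>
     (\<forall>k i j. \<not> (i \<noteq> j \<and> k \<in> nodes_between U i j) \<longrightarrow> Z $ k $ i $ j = 0) \<and>
     (\<forall>k i j. Z $ k $ i $ j = Z $ k $ j $ i)}"

definition stt_polyhedron :: "'v::finite graph \<Rightarrow> 'v lp_point set" where
  "stt_polyhedron U = {(D, X, Z). (D, X, Z) \<in> lp_space U \<and>
     (\<forall>i j. i \<noteq> j \<longrightarrow> X $ i $ j \<ge> 0) \<and>
     (\<forall>i j. i \<noteq> j \<longrightarrow> (\<forall>k \<in> nodes_between U i j. Z $ k $ i $ j \<ge> 0)) \<and>
     (\<forall>i j. i \<noteq> j \<longrightarrow> X $ i $ j + X $ j $ i + (\<Sum>k \<in> nodes_between U i j. Z $ k $ i $ j) \<ge> 1) \<and>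
     (\<forall>i j. i \<noteq> j \<longrightarrow>
        (\<forall>k \<in> nodes_between U i j. Z $ k $ i $ j \<le> X $ k $ i \<and> Z $ k $ i $ j \<le> X $ k $ j)) \<and>
     (\<forall>i. D $ i \<ge> (\<Sum>j \<in> UNIV - {i}. X $ j $ i))}"

definition integer_point :: "'v::finite lp_point \<Rightarrow> bool" where
  "integer_point = (\<lambda>(D, X, Z).
     (\<forall>i. D $ i \<in> \<int>) \<and> (\<forall>i j. X $ i $ j \<in> \<int>) \<and> (\<forall>k i j. Z $ k $ i $ j \<in> \<int>))"

definition induced_X :: "'v::finite rtree \<Rightarrow> real ^ 'v ^ 'v" where
  "induced_X T = (\<chi> i j. if i \<noteq> j \<and> proper_ancestor T i j then 1 else 0)"

definition induced_Z :: "'v::finite graph \<Rightarrow> 'v rtree \<Rightarrow> real ^ 'v ^ 'v ^ 'v" where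
  "induced_Z U T =
     (\<chi> k i j. if i \<noteq> j \<and> k \<in> nodes_between U i j \<and> is_lca T k i j then 1 else 0)"

definition induced_D :: "'v::finite rtree \<Rightarrow> real ^ 'v" where
  "induced_D T = (\<chi> i. \<Sum>j \<in> UNIV - {i}. induced_X T $ j $ i)"

definition induced_point :: "'v::finite graph \<Rightarrow> 'v rtree \<Rightarrow> 'v lp_point" where
  "induced_point U T = (induced_D T, induced_X T, induced_Z U T)"

end

theory Submission
  imports Defs
begin

text \<open>Every tournament \<open>W\<close> on the nodes gives an integer vertex: put \<open>X $ i $ j = 1\<close> if \<open>W i j\<close>
  and let all other \<open>X\<close> and all \<open>Z\<close> vanish. Every coordinate is then determined by tight
  constraints. In a point induced by a search tree the root beats every other node, so a tournament
  without such a node, which exists on any three or more nodes, yields a vertex that is not induced.\<close>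

text \<open>Two nonnegative terms with sum zero both vanish. This carries a constraint that is tight
  at an inner point of a segment over to both endpoints.\<close>

lemma convex_combination_at_lower_bound:
  fixes a b m u :: real
  assumes "m = (1 - u) * a + u * b" "m \<le> a" "m \<le> b" "0 < u" "u < 1"
  shows "a = m" "b = m"
proof -
  have eq: "(1 - u) * (a - m) + u * (b - m) = 0"
    using assms(1) by (simp add: algebra_simps)
  have "0 \<le> (1 - u) * (a - m)" "0 \<le> u * (b - m)"
    using assms by simp_all
  with eq have "(1 - u) * (a - m) = 0" "u * (b - m) = 0"
    by linarith+
  with assms show "a = m" "b = m" by simp_all
qed

definition tournament_X :: "('v::finite \<Rightarrow> 'v \<Rightarrow> bool) \<Rightarrow> real ^ 'v ^ 'v" where
  "tournament_X W = (\<chi> i j. if W i j then 1 else 0)"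

text \<open>The \<open>D\<close> coordinates take their least admissible values, so that the
  constraints on \<open>D\<close> are tight too.\<close>

definition tournament_point :: "('v::finite \<Rightarrow> 'v \<Rightarrow> bool) \<Rightarrow> 'v lp_point" where
  "tournament_point W =
     ((\<chi> i. \<Sum>j \<in> UNIV - {i}. tournament_X W $ j $ i), tournament_X W, 0)"

lemma integer_point_tournament_point: "integer_point (tournament_point W)"
proof -
  have "tournament_X W $ i $ j \<in> \<int>" for i j
    by (simp add: tournament_X_def)
  then show ?thesis
    unfolding integer_point_def tournament_point_def by (simp add: Ints_sum)
qed

text \<open>Exactly one of the two arcs between distinct nodes is present, so the covering
  constraints hold with equality without any help from \<open>Z\<close>, whatever the paths in
  \<open>U\<close> are.\<close>

lemma tournament_point_in_polyhedron:
  assumes W: "\<And>i j. i \<noteq> j \<Longrightarrow> W i j \<longleftrightarrow> \<not> W j i" "\<And>i. \<not> W i i"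
  shows "tournament_point W \<in> stt_polyhedron U"
proof -
  have "(if W i j then 1 else 0) + (if W j i then 1 else 0) = (1::real)" if "i \<noteq> j" for i j
    using W(1)[OF that] by auto
  then show ?thesis
    unfolding tournament_point_def stt_polyhedron_def lp_space_def tournament_X_def
    by (simp add: W(2))
qed

text \<open>The endpoints of a segment through the point are pinned down in stages: nonnegativity
  fixes \<open>Z\<close> and the zero entries of \<open>X\<close>, covering then fixes the remaining
  entries of \<open>X\<close>, and these determine \<open>D\<close>.\<close>

lemma tournament_point_extreme:
  fixes U :: "'v::finite graph"
  assumes W: "\<And>i j. i \<noteq> j \<Longrightarrow> W i j \<longleftrightarrow> \<not> W j i" "\<And>i. \<not> W i i"
  shows "tournament_point W extreme_point_of stt_polyhedron U"
  unfolding extreme_point_of_def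
proof (intro conjI ballI)
  show "tournament_point W \<in> stt_polyhedron U"
    using W by (rule tournament_point_in_polyhedron)
next
  fix a b assume a: "a \<in> stt_polyhedron U" and b: "b \<in> stt_polyhedron U"
  obtain D X Z where a_eq: "a = (D, X, Z)" by (cases a) auto
  obtain D' X' Z' where b_eq: "b = (D', X', Z')" by (cases b) auto
  show "tournament_point W \<notin> open_segment a b"
  proof
    assume "tournament_point W \<in> open_segment a b"
    then obtain u where ab: "a \<noteq> b" and u: "0 < u" "u < 1"
      and seg: "tournament_point W = (1 - u) *\<^sub>R a + u *\<^sub>R b"
      by (auto simp: in_segment)
    have segX: "(if W i j then 1 else 0) = (1 - u) * X $ i $ j + u * X' $ i $ j" for i j
      using seg unfolding a_eq b_eq tournament_point_def tournament_X_def
      by (auto simp: vec_eq_iff)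
    have segZ: "0 = (1 - u) * Z $ k $ i $ j + u * Z' $ k $ i $ j" for k i j
      using seg unfolding a_eq b_eq tournament_point_def
      by (auto simp: vec_eq_iff)
    have segD: "(\<Sum>j \<in> UNIV - {i}. tournament_X W $ j $ i) = (1 - u) * D $ i + u * D' $ i" for i
      using seg unfolding a_eq b_eq tournament_point_def
      by (auto simp: vec_eq_iff)
    \<comment> \<open>Stated for an arbitrary feasible point, to serve both endpoints. Nonnegativity
      extends to the entries that are no LP variables, since \<open>lp_space\<close> fixes them to
      0.\<close>
    have nonneg: "0 \<le> X $ i $ j" "0 \<le> Z $ k $ i $ j"
      and cover: "i \<noteq> j \<Longrightarrow> X $ i $ j + X $ j $ i + (\<Sum>k\<in>nodes_between U i j. Z $ k $ i $ j) \<ge> 1"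
      and depth: "(\<Sum>j \<in> UNIV - {i}. X $ j $ i) \<le> D $ i"
      if "(D, X, Z) \<in> stt_polyhedron U" for D X Z i j k
    proof -
      show "0 \<le> X $ i $ j"
        using that unfolding stt_polyhedron_def lp_space_def by (cases "i = j") simp_all
      show "0 \<le> Z $ k $ i $ j"
        using that unfolding stt_polyhedron_def lp_space_def
        by (cases "i \<noteq> j \<and> k \<in> nodes_between U i j") auto
    qed (use that in \<open>simp_all add: stt_polyhedron_def\<close>)
    note a = a[unfolded a_eq] and b = b[unfolded b_eq]
    have "0 \<le> Z $ k $ i $ j" "0 \<le> Z' $ k $ i $ j" for k i j
      using nonneg a b by blast+
    then have Z0: "Z $ k $ i $ j = 0" "Z' $ k $ i $ j = 0" for k i j
      using convex_combination_at_lower_bound[OF segZ[of k i j] _ _ u] by blast+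
    have X0: "X $ i $ j = 0 \<and> X' $ i $ j = 0" if "\<not> W i j" for i j
    proof -
      have "0 \<le> X $ i $ j" "0 \<le> X' $ i $ j"
        using nonneg a b by blast+
      moreover have "0 = (1 - u) * X $ i $ j + u * X' $ i $ j"
        using segX[of i j] that by simp
      ultimately show ?thesis
        using convex_combination_at_lower_bound u by blast
    qed
    have X1: "X $ i $ j = 1 \<and> X' $ i $ j = 1" if "W i j" for i j
    proof -
      have ij: "i \<noteq> j"
        using W(2) that by blast
      then have ji: "\<not> W j i"
        using W(1) that by blast
      have "X $ i $ j + X $ j $ i + (\<Sum>k\<in>nodes_between U i j. Z $ k $ i $ j) \<ge> 1"
        "X' $ i $ j + X' $ j $ i + (\<Sum>k\<in>nodes_between U i j. Z' $ k $ i $ j) \<ge> 1"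
        using cover a b ij by blast+
      \<comment> \<open>With the opposite arc and all \<open>Z\<close> already zero, covering leaves
        1 as a lower bound, and the convex combination attains it.\<close>
      then have "1 \<le> X $ i $ j" "1 \<le> X' $ i $ j"
        using X0[OF ji] Z0 by simp_all
      moreover have "1 = (1 - u) * X $ i $ j + u * X' $ i $ j"
        using segX[of i j] that by simp
      ultimately show ?thesis
        using convex_combination_at_lower_bound u by blast
    qed
    have X: "X = tournament_X W" "X' = tournament_X W"
      using X0 X1 by (auto simp: vec_eq_iff tournament_X_def)
    \<comment> \<open>Since \<open>X\<close> and \<open>X'\<close> coincide, \<open>D\<close> and
      \<open>D'\<close> have the same lower bound, which is the value at the inner point.\<close>
    have "(\<Sum>j \<in> UNIV - {i}. tournament_X W $ j $ i) \<le> D $ i"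
      "(\<Sum>j \<in> UNIV - {i}. tournament_X W $ j $ i) \<le> D' $ i" for i
      using depth[OF a] depth[OF b] X by simp_all
    then have "D $ i = D' $ i" for i
      using convex_combination_at_lower_bound[OF segD[of i] _ _ u] by simp
    then have "a = b"
      unfolding a_eq b_eq using X Z0 by (simp add: vec_eq_iff)
    with ab show False by simp
  qed
qed

text \<open>A node other than the root lies in its own component, by the one-node path, and by
  induction the child tree over that component contains it.\<close>

lemma stt_on_subset_set_rtree:
  assumes "stt_on U S T"
  shows "S \<subseteq> set_rtree T"
  using assms
proof (induction rule: stt_on.induct)
  case (1 r S f ts)
  show ?case
  proof
    fix v assume v: "v \<in> S"
    show "v \<in> set_rtree (Node r ts)"
    proof (cases "v = r")
      case False
      define C where "C = {w. \<exists>p. simple_path_between U v w p \<and> set p \<subseteq> S - {r}}"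
      have "C \<in> graph_components U (S - {r})"
        using v False unfolding C_def graph_components_def by blast
      moreover have "simple_path_between U v v [v]"
        by (simp add: simple_path_between_def simple_path_def)
      with v False have "v \<in> C"
        unfolding C_def by force
      ultimately have "f C \<in> fset ts" "v \<in> set_rtree (f C)"
        using 1 by blast+
      then show ?thesis by auto
    qed simp
  qed
qed

lemma stt_root_proper_ancestor:
  assumes "stt U T"
  obtains r where "\<And>j. j \<noteq> r \<Longrightarrow> proper_ancestor T r j"
proof -
  obtain r ts where T: "T = Node r ts" by (cases T)
  have "proper_ancestor T r j" if "j \<noteq> r" for j
  proof -
    have "j \<in> set_rtree T"
      using stt_on_subset_set_rtree assms unfolding stt_def by blast
    with that T obtain t where "t |\<in>| ts" "j \<in> set_rtree t" by auto
    then show ?thesis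
      unfolding proper_ancestor_def T using subtree.intros(1) by blast
  qed
  then show ?thesis by (rule that)
qed

text \<open>The transitive tournament with the arc from its source to its sink reversed.\<close>

lemma ex_tournament_without_source:
  assumes "CARD('v) \<ge> 3"
  obtains W :: "'v::finite \<Rightarrow> 'v \<Rightarrow> bool"
  where "\<And>i j. i \<noteq> j \<Longrightarrow> W i j \<longleftrightarrow> \<not> W j i" "\<And>i. \<not> W i i" "\<And>r. \<exists>j. j \<noteq> r \<and> \<not> W r j"
proof -
  define n where "n = CARD('v)"
  obtain h :: "'v \<Rightarrow> nat" where h: "bij_betw h UNIV {0..<n}"
    using ex_bij_betw_finite_nat[of "UNIV :: 'v set"] n_def by auto
  have inj: "h i = h j \<longleftrightarrow> i = j" for i j
    using h by (auto simp: bij_betw_def inj_on_def)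
  have surj: "\<exists>i. h i = m" if "m < n" for m
    using h that unfolding bij_betw_def by (metis atLeastLessThan_iff imageE le0)
  have n: "n \<ge> 3" using assms n_def by simp
  define W where "W i j \<longleftrightarrow> h i < h j \<and> \<not> (h i = 0 \<and> h j = n - 1) \<or> h i = n - 1 \<and> h j = 0" for i j
  have "W i j \<longleftrightarrow> \<not> W j i" if "i \<noteq> j" for i j
    using that inj[of i j] n unfolding W_def by auto
  moreover have "\<not> W i i" for i
    using n unfolding W_def by auto
  moreover have "\<exists>j. j \<noteq> r \<and> \<not> W r j" for r
  proof -
    obtain x y z where xyz: "h x = 0" "h y = 1" "h z = n - 1"
      using surj[of 0] surj[of 1] surj[of "n - 1"] n by auto
    \<comment> \<open>The former source 0 now loses to \<open>n - 1\<close>. Node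
      \<open>n - 1\<close> beats only 0, hence not 1, which differs from \<open>n - 1\<close>
      because \<open>n \<ge> 3\<close>. Every other node loses to 0.\<close>
    consider "h r = 0" | "h r = n - 1" | "h r \<noteq> 0" "h r \<noteq> n - 1" by blast
    then show ?thesis
    proof cases
      case 1
      then show ?thesis using xyz n by (intro exI[of _ z]) (auto simp: W_def)
    next
      case 2
      then show ?thesis using xyz n by (intro exI[of _ y]) (auto simp: W_def)
    next
      case 3
      then show ?thesis using xyz n by (intro exI[of _ x]) (auto simp: W_def)
    qed
  qed
  ultimately show ?thesis by (rule that)
qed

theorem theorem3p7:
  fixes U :: "'v::finite \<Rightarrow> 'v \<Rightarrow> bool"
  assumes "CARD('v) \<ge> 3" and "is_tree U"
  shows "\<exists>p. p extreme_point_of stt_polyhedron U \<and> integer_point p \<and>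
           \<not> (\<exists>T. stt U T \<and> p = induced_point U T)"
proof -
  obtain W :: "'v \<Rightarrow> 'v \<Rightarrow> bool" where W: "\<And>i j. i \<noteq> j \<Longrightarrow> W i j \<longleftrightarrow> \<not> W j i" "\<And>i. \<not> W i i"
    and no_source: "\<And>r. \<exists>j. j \<noteq> r \<and> \<not> W r j"
    using ex_tournament_without_source[OF assms(1)] by blast
  have False if T: "stt U T" and eq: "tournament_point W = induced_point U T" for T
  proof -
    obtain r where r: "\<And>j. j \<noteq> r \<Longrightarrow> proper_ancestor T r j"
      using stt_root_proper_ancestor[OF T] by blast
    obtain j where j: "j \<noteq> r" "\<not> W r j"
      using no_source by blast
    \<comment> \<open>The two points differ in the row of the root: this entry is 0 on the left and
      1 on the right.\<close>
    have "tournament_X W $ r $ j = induced_X T $ r $ j"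
      using eq unfolding tournament_point_def induced_point_def by simp
    with r[OF j(1)] j show False
      by (simp add: tournament_X_def induced_X_def)
  qed
  moreover have "tournament_point W extreme_point_of stt_polyhedron U"
    using W by (rule tournament_point_extreme)
  ultimately show ?thesis
    using integer_point_tournament_point by blast
qed

end
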